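(* A real $2\times 2$ matrix $R$ satisfies $R^2=-I_2$ if and only if there are real numbers $a$ and $b$ with $b\neq 0$ such that $$R=\begin{bmatrix}a&b\\ -\left(\dfrac{1+a^2}{b}\right)&-a\end{bmatrix}.$$
   Context: $I_2$ denotes the $2\times 2$ identity matrix. A square root of a matrix $P$ is a matrix $R$ with $R^2=P$. *)

theory Defs
  imports "HOL-Analysis.Analysis"
begin

end

theory Submission
  imports Defs
begin

text \<open>
  Comparing entries, the equation \<open>R\<^sup>2 = -I\<close> for \<open>R = [[p, q], [r, s]]\<close> becomes
  \<open>p\<^sup>2 + q r = -1\<close>, \<open>q (p + s) = 0\<close>, \<open>r (p + s) = 0\<close>, \<open>r q + s\<^sup>2 = -1\<close>. Over the reals the first
  equation rules out \<open>q = 0\<close>, since a square is never \<open>-1\<close>. Hence one may divide by \<open>q\<close>: the second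
  equation gives \<open>s = -p\<close> and the first gives \<open>r = -(1 + p\<^sup>2) / q\<close>, so that \<open>a = p\<close> and \<open>b = q\<close>
  are the parameters. Conversely, these values solve all four equations.
\<close>

lemma square_eq_minus_mat_1_iff_entries:
  fixes R :: "real^2^2"
  shows "R ** R = - mat 1 \<longleftrightarrow>
    R$1$1 * R$1$1 + R$1$2 * R$2$1 = -1 \<and> R$1$2 * (R$1$1 + R$2$2) = 0 \<and>
    R$2$1 * (R$1$1 + R$2$2) = 0 \<and> R$2$1 * R$1$2 + R$2$2 * R$2$2 = -1"
  by (simp add: vec_eq_iff forall_2 matrix_matrix_mult_def sum_2 mat_def algebra_simps)

lemma eq_vector_2x2_iff_entries:
  fixes R :: "real^2^2"
  shows "R = vector [vector [a, b], vector [c, d]] \<longleftrightarrow>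
    R$1$1 = a \<and> R$1$2 = b \<and> R$2$1 = c \<and> R$2$2 = d"
  by (simp add: vec_eq_iff forall_2)

theorem mainTheorem2:
  fixes R :: "real^2^2"
  shows "R ** R = - mat 1 \<longleftrightarrow>
    (\<exists>a b :: real. b \<noteq> 0 \<and>
      R = vector [vector [a, b],
                  vector [- ((1 + a\<^sup>2) / b), - a]])"
proof
  assume "R ** R = - mat 1"
  then have diag: "R$1$1 * R$1$1 + R$1$2 * R$2$1 = -1"
    and off: "R$1$2 * (R$1$1 + R$2$2) = 0"
    by (simp_all add: square_eq_minus_mat_1_iff_entries)
  have b: "R$1$2 \<noteq> 0"
  proof
    assume "R$1$2 = 0"
    with diag have "R$1$1 * R$1$1 = -1" by simp
    with zero_le_square[of "R$1$1"] show False by linarith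
  qed
  have "R$2$2 = - R$1$1" using off b by auto
  moreover have "R$2$1 = - ((1 + (R$1$1)\<^sup>2) / R$1$2)"
    using diag b by (simp add: field_simps power2_eq_square)
  ultimately show "\<exists>a b :: real. b \<noteq> 0 \<and>
      R = vector [vector [a, b], vector [- ((1 + a\<^sup>2) / b), - a]]"
    using b by (intro exI[of _ "R$1$1"] exI[of _ "R$1$2"]) (simp add: eq_vector_2x2_iff_entries)
next
  assume "\<exists>a b :: real. b \<noteq> 0 \<and>
      R = vector [vector [a, b], vector [- ((1 + a\<^sup>2) / b), - a]]"
  then obtain a b :: real where "b \<noteq> 0" and "R$1$1 = a" "R$1$2 = b"
    "R$2$1 = - ((1 + a\<^sup>2) / b)" "R$2$2 = - a"
    by (auto simp only: eq_vector_2x2_iff_entries)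
  then show "R ** R = - mat 1"
    by (simp add: square_eq_minus_mat_1_iff_entries power2_eq_square)
qed

end
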